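(* Let $X\subset\mathbb{R}^2$ be a real algebraic curve, let $x\in X$ be a smooth point (of a local branch of $X$), and let $u\in\mathbb{R}^2$. Then the squared distance function $\mathbb{D}_u$ is critical at $x$ if and only if $u$ belongs to the normal line $N_x$.
   Context: $X$ is a reduced real algebraic curve all of whose local branches are real and $1$-dimensional. $\mathbb{D}_u(y)=|y-u|^2$ for $y\in X$ (considered on the normalization of $X$, i.e. separately on each local branch). In Euclidean coordinates with $x$ at the origin and the $x_1$-axis along the tangent line, a local branch is parametrized by $x_1(t)=t^p$, $x_2(t)=c\,t^q+\sigma_{q+1}(t)$ with $q>p$, $c\ne0$ and $\sigma_{q+1}$ a real power series with all terms of degree $>q$. The point $x$ is a smooth point of the branch if $p$ is odd; then the branch is locally an embedded $C^1$-submanifold of $\mathbb{R}^2$. At a smooth point, "$\mathbb{D}_u$ is critical at $x$" means that the gradient (derivative) of $\mathbb{D}_u$ at $x$, with respect to the $C^1$-manifold structure of the branch, vanishes. $N_x$ is the line through $x$ orthogonal to the tangent line of the branch at $x$. *)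

theory Defs
  imports
    "HOL-Analysis.Analysis"
    "HOL-Computational_Algebra.Computational_Algebra"
begin

definition eval2 :: "'a::comm_ring_1 poly poly \<Rightarrow> 'a \<Rightarrow> 'a \<Rightarrow> 'a" where
  "eval2 f a b = poly (poly f [:b:]) a"

definition zero_set :: "real poly poly \<Rightarrow> (real^2) set" where
  "zero_set f = {z. eval2 f (z $ 1) (z $ 2) = 0}"

(* (G1, G2) parametrizes, possibly non-primitively, a branch of the complexified curve f = 0
   centred at a real point.  Since f is algebraic, formal and convergent branches coincide. *)
definition complex_branch_param :: "real poly poly \<Rightarrow> complex fps \<Rightarrow> complex fps \<Rightarrow> bool" where
  "complex_branch_param f G1 G2 \<longleftrightarrow>
     eval2 (map_poly (map_poly (\<lambda>c. fps_const (complex_of_real c))) f) G1 G2 = 0 \<and>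
     fps_nth G1 0 \<in> \<real> \<and> fps_nth G2 0 \<in> \<real> \<and>
     \<not> (G1 = fps_const (fps_nth G1 0) \<and> G2 = fps_const (fps_nth G2 0))"

definition complexify_fps :: "real fps \<Rightarrow> complex fps" where
  "complexify_fps R = Abs_fps (\<lambda>n. complex_of_real (fps_nth R n))"

(* A complex branch is real (and then its real locus is 1-dimensional) iff it admits a
   parametrization with real coefficients, through which all its parametrizations factor.
   This excludes, e.g., the isolated real point of x^2 + y^2 = 0. *)
definition all_branches_real :: "real poly poly \<Rightarrow> bool" where
  "all_branches_real f \<longleftrightarrow>
     (\<forall>G1 G2. complex_branch_param f G1 G2 \<longrightarrow>
        (\<exists>R1 R2 \<phi>. fps_nth \<phi> 0 = 0 \<and>
           G1 = complexify_fps R1 oo \<phi> \<and> G2 = complexify_fps R2 oo \<phi>))"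

definition real_algebraic_curve :: "(real^2) set \<Rightarrow> bool" where
  "real_algebraic_curve X \<longleftrightarrow>
     (\<exists>f. squarefree f \<and> all_branches_real f \<and> X = zero_set f)"

(* x_1 = t^p, x_2 = F(t) in the Euclidean coordinates with origin x and axes e1, e2 *)
definition branch_map ::
  "real^2 \<Rightarrow> real^2 \<Rightarrow> real^2 \<Rightarrow> nat \<Rightarrow> real fps \<Rightarrow> real \<Rightarrow> real^2" where
  "branch_map x e1 e2 p F t = x + t ^ p *\<^sub>R e1 + eval_fps F t *\<^sub>R e2"

(* B represents the germ of a local branch of X at x with x_1 = t^p, x_2 = c t^q + ..., where
   q = subdegree F > p and c is the leading coefficient of F; F = 0 is the case of a straight
   branch.  The condition on Gcd says that the parametrization is primitive (not a power series
   in t^k for any k > 1), so that B is a branch and not a folded part of one. *)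
definition local_branch :: "(real^2) set \<Rightarrow> real^2 \<Rightarrow> nat \<Rightarrow> (real^2) set \<Rightarrow> bool" where
  "local_branch X x p B \<longleftrightarrow>
     (\<exists>e1 e2 F r.
        norm e1 = 1 \<and> norm e2 = 1 \<and> orthogonal e1 e2 \<and>
        0 < p \<and> (F = 0 \<or> p < subdegree F) \<and>
        Gcd (insert p {n. fps_nth F n \<noteq> 0}) = 1 \<and>
        0 < r \<and> ereal r \<le> fps_conv_radius F \<and>
        inj_on (branch_map x e1 e2 p F) {-r<..<r} \<and>
        B = branch_map x e1 e2 p F ` {-r<..<r} \<and> B \<subseteq> X)"

definition smooth_point_of_branch :: "(real^2) set \<Rightarrow> real^2 \<Rightarrow> (real^2) set \<Rightarrow> bool" where
  "smooth_point_of_branch X x B \<longleftrightarrow> (\<exists>p. local_branch X x p B \<and> odd p)"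

(* x + v for all limits v of rescaled secant vectors of B at x; the rescaling factors may have
   either sign, so this is a full line even at a cusp *)
definition tangent_line :: "'a::euclidean_space set \<Rightarrow> 'a \<Rightarrow> 'a set" where
  "tangent_line B x =
     {x + v | v. \<exists>y c. (\<forall>n. y n \<in> B - {x}) \<and> y \<longlonglongrightarrow> x \<and>
        (\<lambda>n::nat. c n *\<^sub>R (y n - x)) \<longlonglongrightarrow> v}"

definition normal_line :: "'a::euclidean_space set \<Rightarrow> 'a \<Rightarrow> 'a set" where
  "normal_line B x = {z. \<forall>w \<in> tangent_line B x. orthogonal (z - x) (w - x)}"

(* \<phi> is a local parametrization around x of the embedded 1-dimensional C^1-submanifold B *)
definition C1_param_at ::
  "'a::euclidean_space set \<Rightarrow> 'a \<Rightarrow> (real \<Rightarrow> 'a) \<Rightarrow> bool" where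
  "C1_param_at B x \<phi> \<longleftrightarrow>
     (\<exists>\<epsilon>>0. \<phi> 0 = x \<and> \<phi> C1_differentiable_on {-\<epsilon><..<\<epsilon>} \<and>
        (\<forall>t\<in>{-\<epsilon><..<\<epsilon>}. vector_derivative \<phi> (at t) \<noteq> 0) \<and>
        openin (top_of_set B) (\<phi> ` {-\<epsilon><..<\<epsilon>}) \<and>
        (\<exists>\<psi>. homeomorphism {-\<epsilon><..<\<epsilon>} (\<phi> ` {-\<epsilon><..<\<epsilon>}) \<phi> \<psi>))"

(* B is a C^1-submanifold near x and the derivative of h on B vanishes at x *)
definition critical_at ::
  "('a::euclidean_space \<Rightarrow> real) \<Rightarrow> 'a set \<Rightarrow> 'a \<Rightarrow> bool" where
  "critical_at h B x \<longleftrightarrow>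
     (\<exists>\<phi>. C1_param_at B x \<phi>) \<and>
     (\<forall>\<phi>. C1_param_at B x \<phi> \<longrightarrow> ((h \<circ> \<phi>) has_real_derivative 0) (at 0))"

definition sq_dist :: "'a::euclidean_space \<Rightarrow> 'a \<Rightarrow> real" where
  "sq_dist u y = (norm (y - u))\<^sup>2"

end

(* Substituting s = t^p, which is a homeomorphism for odd p, turns the branch into the graph
   s |-> x + s e1 + H(s) e2 with H(s) = F(root p s).  Since F has no term of degree at most p,
   H' (s) = K(root p s) / p, where F'(t) = t^(p-1) K(t) and K(0) = 0; so H is C^1 with H'(0) = 0
   and the tangent line is x + span e1.  The velocity of every C^1 parametrization at x is a nonzero
   multiple v of e1, and the derivative of the squared distance to u along it is 2 <x - u, v>. *)
theory Submission
  imports Defs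
begin

section \<open>Velocities of parametrizations and the derivative of the squared distance\<close>

text \<open>Secants from \<open>x\<close> to \<open>\<phi> (t n)\<close> with \<open>t n\<close>
  tending to 0, rescaled by \<open>a / t n\<close>, converge to \<open>a\<close> times the velocity.
  It is used both to find the tangent line of a graph and to place the velocity of an arbitrary
  parametrization on that line.\<close>

lemma C1_param_tangent:
  assumes "C1_param_at B x \<phi>"
  shows "x + a *\<^sub>R vector_derivative \<phi> (at 0) \<in> tangent_line B x"
proof -
  obtain \<epsilon> \<psi> where \<epsilon>: "\<epsilon> > 0" "\<phi> 0 = x" "\<phi> C1_differentiable_on {-\<epsilon><..<\<epsilon>}"
      "openin (top_of_set B) (\<phi> ` {-\<epsilon><..<\<epsilon>})"
    and \<psi>: "homeomorphism {-\<epsilon><..<\<epsilon>} (\<phi> ` {-\<epsilon><..<\<epsilon>}) \<phi> \<psi>"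
    using assms unfolding C1_param_at_def by blast
  \<comment> \<open>The shift by 2 keeps \<open>t 0\<close> strictly inside the open parameter
    interval.\<close>
  define t where "t n = \<epsilon> / real (n + 2)" for n
  have t: "0 < t n" "t n < \<epsilon>" for n
    using \<open>\<epsilon> > 0\<close> by (auto simp: t_def divide_simps)
  have t_lim: "t \<longlonglongrightarrow> 0"
    unfolding t_def
    using LIMSEQ_ignore_initial_segment[OF lim_const_over_n[of \<epsilon>], of 2] by simp
  have D: "(\<phi> has_vector_derivative vector_derivative \<phi> (at 0)) (at 0)"
    using \<epsilon>(1,3) by (auto simp: C1_differentiable_on_eq vector_derivative_works)
  have "((\<lambda>s. (\<phi> s - x) /\<^sub>R s) \<longlongrightarrow> vector_derivative \<phi> (at 0)) (at 0)"
  proof -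
    have "((\<lambda>s. norm ((\<phi> s - x) /\<^sub>R s - vector_derivative \<phi> (at 0))) \<longlongrightarrow> 0) (at 0)"
    proof (rule Lim_transform_eventually)
      show "((\<lambda>s. norm (\<phi> s - \<phi> 0 - (s - 0) *\<^sub>R vector_derivative \<phi> (at 0)) / norm (s - 0))
              \<longlongrightarrow> 0) (at 0)"
        using D unfolding has_vector_derivative_def has_derivative_iff_norm by blast
      show "\<forall>\<^sub>F s in at 0. norm (\<phi> s - \<phi> 0 - (s - 0) *\<^sub>R vector_derivative \<phi> (at 0)) / norm (s - 0)
              = norm ((\<phi> s - x) /\<^sub>R s - vector_derivative \<phi> (at 0))"
      proof (rule eventually_at_filter[THEN iffD2], rule always_eventually, intro allI impI)
        fix s :: real assume "s \<noteq> 0"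
        then have "(\<phi> s - x) /\<^sub>R s - vector_derivative \<phi> (at 0)
            = (\<phi> s - \<phi> 0 - (s - 0) *\<^sub>R vector_derivative \<phi> (at 0)) /\<^sub>R s"
          by (simp add: \<epsilon>(2) scaleR_diff_right)
        then show "norm (\<phi> s - \<phi> 0 - (s - 0) *\<^sub>R vector_derivative \<phi> (at 0)) / norm (s - 0)
            = norm ((\<phi> s - x) /\<^sub>R s - vector_derivative \<phi> (at 0))"
          by (simp add: divide_inverse mult.commute)
      qed
    qed
    then show ?thesis
      by (rule LIM_zero_cancel[OF tendsto_norm_zero_cancel])
  qed
  moreover have "filterlim t (at 0) sequentially"
    using t(1) t_lim by (simp add: filterlim_at less_imp_neq[symmetric])
  ultimately have "(\<lambda>n. (\<phi> (t n) - x) /\<^sub>R t n) \<longlonglongrightarrow> vector_derivative \<phi> (at 0)"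
    by (rule filterlim_compose)
  then have "(\<lambda>n. a *\<^sub>R ((\<phi> (t n) - x) /\<^sub>R t n)) \<longlonglongrightarrow> a *\<^sub>R vector_derivative \<phi> (at 0)"
    by (intro tendsto_intros)
  then have "(\<lambda>n. (a / t n) *\<^sub>R (\<phi> (t n) - x)) \<longlonglongrightarrow> a *\<^sub>R vector_derivative \<phi> (at 0)"
    by (simp add: divide_inverse)
  moreover have "\<phi> (t n) \<in> B - {x}" for n
  proof -
    have "\<phi> (t n) \<in> B"
      using openin_imp_subset[OF \<epsilon>(4)] t[of n] by force
    \<comment> \<open>The inverse \<open>\<psi>\<close> makes \<open>\<phi>\<close> injective, so
      the secants do not degenerate.\<close>
    moreover have "\<psi> (\<phi> (t n)) = t n" "\<psi> (\<phi> 0) = 0"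
      using \<psi> t[of n] \<open>\<epsilon> > 0\<close> by (auto simp: homeomorphism_def)
    then have "\<phi> (t n) \<noteq> x"
      using \<epsilon>(2) t(1)[of n] by force
    ultimately show ?thesis by blast
  qed
  moreover have "(\<lambda>n. \<phi> (t n)) \<longlonglongrightarrow> x"
    using isCont_tendsto_compose[OF has_vector_derivative_continuous[OF D] t_lim] \<epsilon>(2) by simp
  ultimately show ?thesis
    unfolding tangent_line_def mem_Collect_eq
    by (intro exI[of _ "a *\<^sub>R vector_derivative \<phi> (at 0)"] exI[of _ "\<lambda>n. \<phi> (t n)"]
        exI[of _ "\<lambda>n. a / t n"] conjI allI refl)
qed

lemma sq_dist_has_derivative:
  assumes "(\<phi> has_vector_derivative v) (at t)"
  shows "((sq_dist u \<circ> \<phi>) has_real_derivative 2 * ((\<phi> t - u) \<bullet> v)) (at t)"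
  using assms unfolding has_vector_derivative_def has_field_derivative_def sq_dist_def o_def
    power2_norm_eq_inner
  by (auto intro!: derivative_eq_intros simp: fun_eq_iff inner_commute algebra_simps)

section \<open>Graphs of C^1 functions and their tangent lines\<close>

definition graph_map :: "'a::real_vector \<Rightarrow> 'a \<Rightarrow> 'a \<Rightarrow> (real \<Rightarrow> real) \<Rightarrow> real \<Rightarrow> 'a" where
  "graph_map x e1 e2 H s = x + s *\<^sub>R e1 + H s *\<^sub>R e2"

text \<open>Pairing with \<open>e1\<close> is thus a continuous left inverse: it yields the
  homeomorphism below and recovers the parameter of a point on a secant.\<close>

lemma graph_map_coordinate:
  assumes "norm e1 = 1" "orthogonal e1 e2"
  shows "(graph_map x e1 e2 H s - x) \<bullet> e1 = s"
  using assms
  by (simp add: graph_map_def inner_left_distrib inner_right_distrib orthogonal_def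
      inner_commute flip: norm_eq_1)

text \<open>The velocity \<open>e1 + H' s *\<^sub>R e2\<close> has inner product 1 with
  \<open>e1\<close>, hence never vanishes. The inverse is the projection along \<open>e2\<close>
  onto the \<open>e1\<close> coordinate.\<close>

lemma C1_param_graph_map:
  fixes e1 e2 :: "'a::euclidean_space"
  assumes e: "norm e1 = 1" "orthogonal e1 e2"
    and R: "R > 0"
    and H: "H 0 = 0" "\<And>s. \<bar>s\<bar> < R \<Longrightarrow> (H has_real_derivative H' s) (at s)"
      "continuous_on {-R<..<R} H'"
  shows "C1_param_at (graph_map x e1 e2 H ` {-R<..<R}) x (graph_map x e1 e2 H)"
    and "vector_derivative (graph_map x e1 e2 H) (at 0) = e1 + H' 0 *\<^sub>R e2"
proof -
  let ?g = "graph_map x e1 e2 H" and ?I = "{-R<..<R}"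
  let ?D = "\<lambda>s. e1 + H' s *\<^sub>R e2"
  have D: "(?g has_vector_derivative ?D s) (at s)" if "s \<in> ?I" for s
  proof -
    have "(H has_real_derivative H' s) (at s)"
      using H(2)[of s] that by (simp add: abs_less_iff)
    then show ?thesis
      unfolding graph_map_def by (auto intro!: derivative_eq_intros)
  qed
  have vD: "vector_derivative ?g (at s) = ?D s" if "s \<in> ?I" for s
    using D[OF that] by (rule vector_derivative_at)
  show "vector_derivative ?g (at 0) = ?D 0"
    using vD R by simp
  have "?D s \<bullet> e1 = 1" for s
    using e by (simp add: inner_left_distrib inner_right_distrib orthogonal_def inner_commute flip: norm_eq_1)
  then have "?D s \<noteq> 0" for s
    by (metis inner_zero_left zero_neq_one)
  moreover have "?g C1_differentiable_on ?I"
    unfolding C1_differentiable_on_def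
  proof (intro exI[of _ ?D] conjI ballI)
    show "continuous_on ?I ?D"
      using H(3) by (intro continuous_intros)
  qed (rule D)
  moreover have "homeomorphism ?I (?g ` ?I) ?g (\<lambda>y. (y - x) \<bullet> e1)"
  proof (rule homeomorphismI)
    show "continuous_on ?I ?g"
      by (rule continuous_at_imp_continuous_on) (use has_vector_derivative_continuous[OF D] in auto)
    show "continuous_on (?g ` ?I) (\<lambda>y. (y - x) \<bullet> e1)"
      by (intro continuous_intros)
  qed (auto simp: graph_map_coordinate[OF e])
  moreover have "?g 0 = x"
    using H(1) by (simp add: graph_map_def)
  moreover have "openin (top_of_set (?g ` ?I)) (?g ` ?I)"
    by simp
  ultimately show "C1_param_at (?g ` ?I) x ?g"
    unfolding C1_param_at_def using R vD by metis
qed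

text \<open>One inclusion is \<open>C1_param_tangent\<close> for the velocity \<open>e1\<close>. For
  the other, the \<open>e2\<close> coordinate of a rescaled secant is its \<open>e1\<close>
  coordinate times \<open>H s / s\<close>, and this slope tends to \<open>H' 0 = 0\<close>.\<close>

lemma tangent_line_graph:
  fixes e1 e2 :: "'a::euclidean_space"
  assumes e: "norm e1 = 1" "orthogonal e1 e2"
    and R: "R > 0"
    and H: "H 0 = 0" "\<And>s. \<bar>s\<bar> < R \<Longrightarrow> (H has_real_derivative H' s) (at s)"
      "continuous_on {-R<..<R} H'" "H' 0 = 0"
  shows "tangent_line (graph_map x e1 e2 H ` {-R<..<R}) x = range (\<lambda>a. x + a *\<^sub>R e1)"
proof
  let ?g = "graph_map x e1 e2 H" and ?I = "{-R<..<R}"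
  show "range (\<lambda>a. x + a *\<^sub>R e1) \<subseteq> tangent_line (?g ` ?I) x"
    using C1_param_tangent[OF C1_param_graph_map(1)[OF e R H(1-3)]]
      C1_param_graph_map(2)[OF e R H(1-3)] H(4)
    by auto
  show "tangent_line (?g ` ?I) x \<subseteq> range (\<lambda>a. x + a *\<^sub>R e1)"
  proof
    fix z assume "z \<in> tangent_line (?g ` ?I) x"
    then obtain v y c where z: "z = x + v" and y: "\<And>n. y n \<in> ?g ` ?I - {x}" "y \<longlonglongrightarrow> x"
      and c: "(\<lambda>n. c n *\<^sub>R (y n - x)) \<longlonglongrightarrow> v"
      unfolding tangent_line_def by blast
    define s where "s n = (y n - x) \<bullet> e1" for n
    have y_s: "y n = ?g (s n)" for n
      using y(1)[of n] graph_map_coordinate[OF e] by (auto simp: s_def)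
    have "s n \<noteq> 0" for n
      using y(1)[of n] y_s[of n] H(1) by (auto simp: graph_map_def)
    moreover have "s \<longlonglongrightarrow> 0"
      unfolding s_def using y(2) by (auto intro!: tendsto_eq_intros)
    ultimately have "filterlim s (at 0) sequentially"
      by (simp add: filterlim_at)
    moreover have "((\<lambda>s. H s / s) \<longlongrightarrow> 0) (at 0)"
      using H(1) H(2)[of 0] H(4) R by (simp add: has_field_derivative_iff)
    ultimately have "(\<lambda>n. H (s n) / s n) \<longlonglongrightarrow> 0"
      using filterlim_compose by blast
    \<comment> \<open>The factors \<open>c n\<close> may be unbounded, but the products
      \<open>c n * s n\<close> converge, so multiplying them by the slopes gives a null
      sequence.\<close>
    moreover have cs: "(\<lambda>n. c n * s n) \<longlonglongrightarrow> v \<bullet> e1"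
      using tendsto_inner[OF c tendsto_const[of e1]] by (simp add: s_def)
    ultimately have "(\<lambda>n. c n * s n * (H (s n) / s n)) \<longlonglongrightarrow> (v \<bullet> e1) * 0"
      by (intro tendsto_mult)
    then have "(\<lambda>n. c n * H (s n)) \<longlonglongrightarrow> 0"
      using \<open>\<And>n. s n \<noteq> 0\<close> by simp
    then have "(\<lambda>n. (c n * s n) *\<^sub>R e1 + (c n * H (s n)) *\<^sub>R e2) \<longlonglongrightarrow> (v \<bullet> e1) *\<^sub>R e1 + 0 *\<^sub>R e2"
      using cs by (intro tendsto_intros)
    moreover have "(c n * s n) *\<^sub>R e1 + (c n * H (s n)) *\<^sub>R e2 = c n *\<^sub>R (y n - x)" for n
      by (simp add: y_s graph_map_def scaleR_add_right)
    ultimately have "(\<lambda>n. c n *\<^sub>R (y n - x)) \<longlonglongrightarrow> (v \<bullet> e1) *\<^sub>R e1"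
      by simp
    then have "v = (v \<bullet> e1) *\<^sub>R e1"
      using c LIMSEQ_unique by blast
    then show "z \<in> range (\<lambda>a. x + a *\<^sub>R e1)"
      using z by (intro range_eqI[of _ _ "v \<bullet> e1"]) simp
  qed
qed

section \<open>Branches with odd exponent as graphs\<close>

lemma odd_power_image_symmetric_interval:
  fixes r :: real
  assumes "odd p"
  shows "(\<lambda>t. t ^ p) ` {-r<..<r} = {-(r ^ p)<..<r ^ p}"
proof -
  have "s \<in> (\<lambda>t. t ^ p) ` {-r<..<r}" if "s \<in> {-(r ^ p)<..<r ^ p}" for s
  proof (rule image_eqI)
    have "root p (- (r ^ p)) < root p s" "root p s < root p (r ^ p)"
      using that odd_pos[OF assms] by (simp_all only: real_root_less_iff greaterThanLessThan_iff)
    then show "root p s \<in> {-r<..<r}"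
      using assms by (simp add: real_root_minus odd_real_root_power_cancel)
  qed (use assms in \<open>simp add: odd_real_root_pow\<close>)
  moreover have "- (r ^ p) < t ^ p" "t ^ p < r ^ p" if "- r < t" "t < r" for t
  proof -
    have "\<bar>t ^ p\<bar> < r ^ p"
      using that odd_pos[OF assms] by (auto simp: power_abs intro!: power_strict_mono)
    then show "- (r ^ p) < t ^ p" "t ^ p < r ^ p"
      by auto
  qed
  ultimately show ?thesis
    by auto
qed

text \<open>Two quotients of power series do the work: \<open>K\<close>, the derivative of
  \<open>F\<close> divided by \<open>fps_X ^ (p - 1)\<close>, describes \<open>H'\<close>, and
  \<open>G\<close>, which is \<open>F\<close> divided by \<open>fps_X ^ p\<close>, describes the
  difference quotients of \<open>H\<close> at 0.\<close>

lemma odd_branch_graph: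
  fixes F :: "real fps"
  assumes "odd p" "F = 0 \<or> p < subdegree F" "0 < r" "ereal r \<le> fps_conv_radius F"
  obtains H H' where
    "branch_map x e1 e2 p F ` {-r<..<r} = graph_map x e1 e2 H ` {-(r ^ p)<..<r ^ p}"
    "H 0 = 0" "H' 0 = 0" "continuous_on {-(r ^ p)<..<r ^ p} H'"
    "\<And>s. \<bar>s\<bar> < r ^ p \<Longrightarrow> (H has_real_derivative H' s) (at s)"
proof -
  have p: "p > 0"
    using \<open>odd p\<close> by (rule odd_pos)
  define G where "G = fps_shift p F"
  define K where "K = fps_shift (p - 1) (fps_deriv F)"
  define H where "H = (\<lambda>s. eval_fps F (root p s))"
  define H' where "H' = (\<lambda>s. eval_fps K (root p s) / real p)"
  have F: "F = G * fps_X ^ p"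
    using assms(2) by (auto simp: G_def fps_shift_times_fps_X_power)
  \<comment> \<open>The coefficient of degree exactly \<open>p\<close> matters: its vanishing kills
    the constant terms of both \<open>G\<close> and \<open>K\<close>. The lower ones make the
    division defining \<open>K\<close> exact.\<close>
  have F_nth: "fps_nth F n = 0" if "n \<le> p" for n
    using assms(2) that by (metis fps_zero_nth nth_less_subdegree_zero order.strict_trans1)
  have G0: "fps_nth G 0 = 0"
    by (simp add: G_def F_nth)
  have dF: "fps_deriv F = K * fps_X ^ (p - 1)"
    by (rule fps_ext) (simp add: K_def fps_X_power_mult_right_nth F_nth)
  have G_radius: "fps_conv_radius G = fps_conv_radius F"
    by (simp add: G_def)
  have K_radius: "fps_conv_radius K \<ge> fps_conv_radius F"
    using fps_conv_radius_deriv[of F] by (simp add: K_def)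
  have rad: "ereal \<bar>root p s\<bar> < fps_conv_radius F" if "\<bar>s\<bar> < r ^ p" for s
  proof -
    have "\<bar>root p s\<bar> < root p (r ^ p)"
      using that p by (simp only: real_root_abs[symmetric] real_root_less_iff)
    then have "\<bar>root p s\<bar> < r"
      using assms by (simp add: odd_real_root_power_cancel)
    then show ?thesis
      using assms(4) by (meson ereal_less_eq(3) less_ereal.simps(1) order.strict_trans2)
  qed
  have eval_F: "eval_fps F t = eval_fps G t * t ^ p" if "ereal \<bar>t\<bar> < fps_conv_radius F" for t
    using that unfolding F by (subst eval_fps_mult) (auto simp: G_radius simp flip: F)
  have eval_dF: "eval_fps (fps_deriv F) t = eval_fps K t * t ^ (p - 1)"
    if "ereal \<bar>t\<bar> < fps_conv_radius F" for t
    using that K_radius unfolding dF by (subst eval_fps_mult) (auto simp: order.strict_trans2)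
  have K0: "fps_nth K 0 = 0"
    using p by (simp add: K_def F_nth)
  show thesis
  proof
    show "branch_map x e1 e2 p F ` {-r<..<r} = graph_map x e1 e2 H ` {-(r ^ p)<..<r ^ p}"
      unfolding odd_power_image_symmetric_interval[OF \<open>odd p\<close>, symmetric] image_image
        branch_map_def graph_map_def H_def
      by (simp add: odd_real_root_power_cancel[OF \<open>odd p\<close>])
    show "H 0 = 0"
      by (simp add: H_def eval_fps_at_0 F_nth)
    show "H' 0 = 0"
      by (simp add: H'_def eval_fps_at_0 K0)
    have "continuous_on {-(r ^ p)<..<r ^ p} (\<lambda>s. eval_fps K (root p s))"
    proof (rule continuous_on_eval_fps')
      show "root p ` {-(r ^ p)<..<r ^ p} \<subseteq> eball 0 (fps_conv_radius K)"
        using order.strict_trans2[OF rad K_radius] by (auto simp: abs_less_iff)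
    qed (intro continuous_intros)
    then show "continuous_on {-(r ^ p)<..<r ^ p} H'"
      unfolding H'_def by (rule continuous_on_divide) (use p in auto)
    fix s :: real assume s: "\<bar>s\<bar> < r ^ p"
    show "(H has_real_derivative H' s) (at s)"
    proof (cases "s = 0")
      case False
      define t where "t = root p s"
      have "(eval_fps F has_real_derivative eval_fps (fps_deriv F) t) (at t)"
        using rad[OF s] by (intro has_field_derivative_eval_fps) (simp add: t_def)
      then have "(H has_real_derivative
          eval_fps (fps_deriv F) t * inverse (real p * t ^ (p - Suc 0))) (at s)"
        unfolding H_def t_def
        by (rule DERIV_chain2) (rule DERIV_odd_real_root[OF \<open>odd p\<close> False])
      moreover have "t \<noteq> 0"
        using False p by (simp add: t_def)
      \<comment> \<open>The factor \<open>t ^ (p - 1)\<close> of the derivative of \<open>F\<close>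
        cancels against the one in the derivative of the root.\<close>
      ultimately show ?thesis
        using eval_dF[of t] rad[OF s] by (simp add: t_def H'_def field_simps)
    next
      case True
      \<comment> \<open>For \<open>p > 1\<close> the root is not differentiable at 0, so the chain
        rule gives way to the difference quotient: since \<open>root p s ^ p = s\<close>,
        \<open>H s / s\<close> is the value of \<open>G\<close> at \<open>root p s\<close>, which
        tends to the constant term 0.\<close>
      have "isCont (eval_fps G) 0"
        using has_field_derivative_eval_fps[of 0 G UNIV] rad[of 0] G_radius assms(3)
        by (auto intro!: DERIV_isCont)
      then have "((\<lambda>s. eval_fps G (root p s)) \<longlongrightarrow> eval_fps G 0) (at 0)"
        by (rule isCont_tendsto_compose) (use isCont_real_root[of 0 p] in \<open>simp add: isCont_def\<close>)
      then have "((\<lambda>s. eval_fps G (root p s)) \<longlongrightarrow> 0) (at 0)"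
        by (simp add: eval_fps_at_0 G0)
      moreover have "\<forall>\<^sub>F s in at 0. eval_fps G (root p s) = (H s - H 0) / (s - 0)"
        unfolding eventually_at
      proof (intro exI[of _ "r ^ p"] conjI ballI impI)
        fix s :: real assume "s \<noteq> 0 \<and> dist s 0 < r ^ p"
        then show "eval_fps G (root p s) = (H s - H 0) / (s - 0)"
          using eval_F[OF rad[of s]] \<open>H 0 = 0\<close> \<open>odd p\<close> by (simp add: H_def odd_real_root_pow)
      qed (use \<open>0 < r\<close> in auto)
      ultimately have "((\<lambda>s. (H s - H 0) / (s - 0)) \<longlongrightarrow> 0) (at 0)"
        by (rule Lim_transform_eventually)
      then show ?thesis
        using True \<open>H' 0 = 0\<close> by (simp add: has_field_derivative_iff)
    qed
  qed
qed

section \<open>Criticality and the normal line\<close>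

theorem proposition2:
  fixes X B :: "(real^2) set" and x u :: "real^2"
  assumes "real_algebraic_curve X"
    and "x \<in> X"
    and "smooth_point_of_branch X x B"
  shows "critical_at (sq_dist u) B x \<longleftrightarrow> u \<in> normal_line B x"
proof -
  obtain p e1 e2 F r where e: "norm e1 = 1" "orthogonal e1 e2"
    and F: "odd p" "F = 0 \<or> p < subdegree F" "0 < r" "ereal r \<le> fps_conv_radius F"
    and B: "B = branch_map x e1 e2 p F ` {-r<..<r}"
    using assms(3) unfolding smooth_point_of_branch_def local_branch_def by blast
  obtain H H' where H: "H 0 = 0" "\<And>s. \<bar>s\<bar> < r ^ p \<Longrightarrow> (H has_real_derivative H' s) (at s)"
      "continuous_on {-(r ^ p)<..<r ^ p} H'" "H' 0 = 0"
    and B_graph: "B = graph_map x e1 e2 H ` {-(r ^ p)<..<r ^ p}"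
    using odd_branch_graph[OF F] B by metis
  have r: "r ^ p > 0"
    using \<open>0 < r\<close> by simp
  have param: "C1_param_at B x (graph_map x e1 e2 H)"
    unfolding B_graph using C1_param_graph_map(1)[OF e r H(1-3)] .
  have tangent: "tangent_line B x = range (\<lambda>a. x + a *\<^sub>R e1)"
    unfolding B_graph using tangent_line_graph[OF e r H] .
  \<comment> \<open>Orthogonality to the whole tangent line is tested on the single point with
    \<open>a = 1\<close>.\<close>
  have normal: "u \<in> normal_line B x \<longleftrightarrow> (x - u) \<bullet> e1 = 0"
    unfolding normal_line_def tangent
    by (auto simp: orthogonal_def inner_diff_left dest: spec[of _ 1])
  \<comment> \<open>The right-hand side does not mention \<open>\<phi>\<close>, so criticality is
    independent of the parametrization.\<close>
  have "((sq_dist u \<circ> \<phi>) has_real_derivative 0) (at 0) \<longleftrightarrow> (x - u) \<bullet> e1 = 0"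
    if param_\<phi>: "C1_param_at B x \<phi>" for \<phi>
  proof -
    let ?v = "vector_derivative \<phi> (at 0)"
    have \<phi>: "\<phi> 0 = x" "(\<phi> has_vector_derivative ?v) (at 0)" "?v \<noteq> 0"
      using param_\<phi>
      by (auto simp: C1_param_at_def C1_differentiable_on_eq simp flip: vector_derivative_works)
    \<comment> \<open>The tangent line was computed from the graph but depends only on the set
      \<open>B\<close>, so it also contains the velocity of \<open>\<phi>\<close>. Since
      \<open>?v\<close> is nonzero, so is \<open>a\<close>, and it can be cancelled at the
      end.\<close>
    obtain a where "x + 1 *\<^sub>R ?v = x + a *\<^sub>R e1"
      using C1_param_tangent[OF param_\<phi>, of 1] unfolding tangent by blast
    then have a: "?v = a *\<^sub>R e1"
      by simp
    have "((sq_dist u \<circ> \<phi>) has_real_derivative 2 * ((x - u) \<bullet> ?v)) (at 0)"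
      using sq_dist_has_derivative[OF \<phi>(2), of u] \<phi>(1) by simp
    then have "((sq_dist u \<circ> \<phi>) has_real_derivative 0) (at 0) \<longleftrightarrow> (x - u) \<bullet> ?v = 0"
      using DERIV_unique by force
    then show ?thesis
      using a \<phi>(3) by simp
  qed
  then show ?thesis
    \<comment> \<open>\<open>param\<close> serves twice: it is the existence clause of
      \<open>critical_at\<close>, and it instantiates the universal clause when criticality is
      assumed.\<close>
    unfolding critical_at_def normal using param by blast
qed

end
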